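(* Let $m\in[0,1)$ be such that $|\Theta_m|\ge 2$. Then there does not exist any sequence of estimators $T_N:\{-1,1\}^N\to\mathbb{R}^2$, $N\ge 1$, that is consistent for $(\beta,p)\in\Theta_m$; that is, there is no sequence $(T_N)_{N\ge1}$ such that for every $(\beta,p)\in\Theta_m$ and every $\varepsilon>0$, $\mathbb{P}_{\beta,p}\big(\|T_N(\boldsymbol X)-(\beta,p)\|>\varepsilon\big)\to 0$ as $N\to\infty$, where $\boldsymbol X=(X_1,\ldots,X_N)\sim\mathbb{P}_{\beta,p}$ is a single sample from the $p$-spin Curie-Weiss model on $\{-1,1\}^N$.
   Context: For $\beta>0$, an integer $p\ge 2$ and $N\ge 1$, the $p$-spin Curie-Weiss model is the probability measure on $\{-1,1\}^N$ given by $\mathbb{P}_{\beta,p}(\boldsymbol x)=\exp\{\beta N\bar x^{\,p}\}/Z_N(\beta,p)$, where $\bar x=\frac1N\sum_{i=1}^N x_i$ and $Z_N(\beta,p)$ is the normalizing constant (the dependence of $\mathbb{P}_{\beta,p}$ on $N$ is suppressed). For $x\in[0,1]$ let $H_{\beta,p}(x)=\beta x^p-\frac12\{(1+x)\log(1+x)+(1-x)\log(1-x)\}$, with the convention $0\log 0=0$. Let $D$ be the set of all integers $\ge 3$. For $m\in[0,1)$, $\Theta_m=\{(\beta,p)\in(0,\infty)\times D: m \text{ is the unique non-negative global maximizer of } H_{\beta,p}\}$, i.e. the unique global maximizer of $H_{\beta,p}$ on $[0,1]$. *)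

theory Defs
  imports "HOL-Probability.Probability"
begin

text \<open>Configurations are extensional functions on \<open>{1..N}\<close>, so that each element of
  \<open>{-1,1}^N\<close> has exactly one representative.\<close>

definition configs :: "nat \<Rightarrow> (nat \<Rightarrow> real) set" where
  "configs N = {1..N} \<rightarrow>\<^sub>E {-1, 1}"

definition mean_spin :: "nat \<Rightarrow> (nat \<Rightarrow> real) \<Rightarrow> real" where
  "mean_spin N x = (\<Sum>i=1..N. x i) / real N"

definition partition_fun :: "nat \<Rightarrow> real \<Rightarrow> nat \<Rightarrow> real" where
  "partition_fun N \<beta> p = (\<Sum>x\<in>configs N. exp (\<beta> * real N * mean_spin N x ^ p))"

definition curie_weiss :: "nat \<Rightarrow> real \<Rightarrow> nat \<Rightarrow> (nat \<Rightarrow> real) measure" where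
  "curie_weiss N \<beta> p = point_measure (configs N)
     (\<lambda>x. ennreal (exp (\<beta> * real N * mean_spin N x ^ p) / partition_fun N \<beta> p))"

text \<open>The convention \<open>0 log 0 = 0\<close> (needed at \<open>x = 1\<close>) holds because \<open>0 * ln 0 = 0\<close>.\<close>

definition H :: "real \<Rightarrow> nat \<Rightarrow> real \<Rightarrow> real" where
  "H \<beta> p x = \<beta> * x ^ p - 1/2 * ((1 + x) * ln (1 + x) + (1 - x) * ln (1 - x))"

definition unique_global_maximizer :: "(real \<Rightarrow> real) \<Rightarrow> real set \<Rightarrow> real \<Rightarrow> bool" where
  "unique_global_maximizer f S m \<longleftrightarrow> (\<forall>x. is_arg_max f (\<lambda>y. y \<in> S) x \<longleftrightarrow> x = m)"

definition Theta :: "real \<Rightarrow> (real \<times> nat) set" where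
  "Theta m = {(\<beta>, p). \<beta> > 0 \<and> p \<ge> 3 \<and> unique_global_maximizer (H \<beta> p) {0..1} m}"

text \<open>The value of \<open>T N\<close> outside \<open>configs N\<close> is irrelevant. The norm on \<open>real \<times> real\<close> is
  the Euclidean one.\<close>

definition consistent_estimators ::
  "(nat \<Rightarrow> (nat \<Rightarrow> real) \<Rightarrow> real \<times> real) \<Rightarrow> (real \<times> nat) set \<Rightarrow> bool" where
  "consistent_estimators T S \<longleftrightarrow>
     (\<forall>(\<beta>, p)\<in>S. \<forall>\<epsilon>>0.
        (\<lambda>N. measure (curie_weiss N \<beta> p)
               {x \<in> space (curie_weiss N \<beta> p). norm (T N x - (\<beta>, real p)) > \<epsilon>})
          \<longlonglongrightarrow> 0)"

lemma finite_configs [simp]: "finite (configs N)"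
  by (simp add: configs_def finite_PiE)

lemma configs_nonempty [simp]: "configs N \<noteq> {}"
  by (simp add: configs_def PiE_eq_empty_iff)

lemma partition_fun_pos: "partition_fun N \<beta> p > 0"
  unfolding partition_fun_def by (rule sum_pos) auto

lemma space_curie_weiss [simp]: "space (curie_weiss N \<beta> p) = configs N"
  by (simp add: curie_weiss_def space_point_measure)

lemma sets_curie_weiss [simp]: "sets (curie_weiss N \<beta> p) = Pow (configs N)"
  by (simp add: curie_weiss_def sets_point_measure)

lemma measure_curie_weiss:
  assumes "A \<subseteq> configs N"
  shows "measure (curie_weiss N \<beta> p) A =
    (\<Sum>x\<in>A. exp (\<beta> * real N * mean_spin N x ^ p)) / partition_fun N \<beta> p"
proof -
  have nonneg: "0 \<le> exp (\<beta> * real N * mean_spin N x ^ p) / partition_fun N \<beta> p" for x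
    using partition_fun_pos[of N \<beta> p] by simp
  have "emeasure (curie_weiss N \<beta> p) A =
      ennreal (\<Sum>x\<in>A. exp (\<beta> * real N * mean_spin N x ^ p) / partition_fun N \<beta> p)"
    unfolding curie_weiss_def
    using assms nonneg by (subst emeasure_point_measure_finite) (auto simp: sum_ennreal)
  then show ?thesis
    using nonneg by (simp add: measure_def sum_nonneg sum_divide_distrib)
qed

lemma prob_space_curie_weiss: "prob_space (curie_weiss N \<beta> p)"
proof
  have "measure (curie_weiss N \<beta> p) (configs N) = 1"
    using partition_fun_pos[of N \<beta> p] measure_curie_weiss[of "configs N" N \<beta> p]
    by (simp add: partition_fun_def)
  then show "emeasure (curie_weiss N \<beta> p) (space (curie_weiss N \<beta> p)) = 1"
    by (metis emeasure_eq_ennreal_measure ennreal_1 measure_zero_top space_curie_weiss zero_neq_one)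
qed

end

theory Submission
  imports Defs "HOL-Real_Asymp.Real_Asymp"
begin

text \<open>Let \<open>Q\<close> be the product measure on configurations with mean \<open>m\<close>. For every
  \<open>(\<beta>, p) \<in> Theta m\<close> the point \<open>m\<close> is a critical point of \<open>H \<beta> p\<close>, so on the typical window
  \<open>\<bar>y - m\<bar> \<le> sqrt (2 / N)\<close> of the magnetization \<open>y\<close> the Gibbs weight agrees with
  \<open>2 ^ N * exp (N * H \<beta> p m) * Q\<close> up to a bounded factor. The partition function is at most a
  constant times \<open>2 ^ N * exp (N * H \<beta> p m)\<close>, because \<open>H \<beta> p\<close> is nondegenerate at its maximizer.
  Hence on this window, which has \<open>Q\<close>-measure at least \<open>1/2\<close> by Chebyshev, every Gibbs measure with
  parameter in \<open>Theta m\<close> dominates a constant multiple of the same \<open>Q\<close>, and no estimator can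
  separate two of them.\<close>

text \<open>This is \<open>ln 2\<close> minus the cross entropy of the laws on {-1, 1} with means
  \<open>y\<close> and \<open>z\<close>. On the diagonal it is the entropy term of
  \<open>H\<close>.\<close>

definition cross_entropy :: "real \<Rightarrow> real \<Rightarrow> real" where
  "cross_entropy y z = (1 + y) / 2 * ln (1 + z) + (1 - y) / 2 * ln (1 - z)"

definition biased :: "nat \<Rightarrow> real \<Rightarrow> (nat \<Rightarrow> real) \<Rightarrow> real" where
  "biased N z x = (\<Prod>i=1..N. (1 + z * x i) / 2)"

subsection \<open>Product measures\<close>

lemma configs_cases: "x \<in> configs N \<Longrightarrow> i \<in> {1..N} \<Longrightarrow> x i = -1 \<or> x i = 1"
  by (auto simp: configs_def PiE_iff)

lemma sum_configs_prod:
  "(\<Sum>x\<in>configs N. \<Prod>i=1..N. f i (x i)) = (\<Prod>i=1..N. f i (-1) + f i (1::real) :: real)"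
proof -
  have "(\<Prod>i=1..N. \<Sum>s\<in>{-1,1}. f i s) = (\<Sum>x\<in>configs N. \<Prod>i=1..N. f i (x i))"
    unfolding configs_def by (rule prod_sum_PiE) auto
  then show ?thesis by simp
qed

lemma sum_biased: "(\<Sum>x\<in>configs N. biased N z x) = 1"
  unfolding biased_def by (subst sum_configs_prod) (simp add: field_simps)

lemma biased_nonneg:
  assumes "x \<in> configs N" "\<bar>z\<bar> \<le> 1"
  shows "0 \<le> biased N z x"
  unfolding biased_def using assms by (intro prod_nonneg) (auto dest!: configs_cases)

text \<open>By independence of the spins the sum factorizes over sites; off the diagonal the factor
  of site \<open>i\<close> alone is 0.\<close>

lemma biased_covariance:
  assumes "i \<in> {1..N}" "j \<in> {1..N}"
  shows "(\<Sum>x\<in>configs N. biased N z x * ((x i - z) * (x j - z))) = (if i = j then 1 - z\<^sup>2 else 0)"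
proof -
  \<comment> \<open>The two conditionals stay separate, so that for \<open>i = j\<close> both act at
    the same site and produce the square.\<close>
  define f where "f k s = (1 + z * s) / 2 * ((if k = i then s - z else 1) * (if k = j then s - z else 1))"
    for k :: nat and s :: real
  have "(\<Sum>x\<in>configs N. biased N z x * ((x i - z) * (x j - z)))
      = (\<Sum>x\<in>configs N. \<Prod>k=1..N. f k (x k))"
  proof (intro sum.cong refl)
    fix x
    have "(\<Prod>k=1..N. f k (x k)) = biased N z x *
        ((\<Prod>k=1..N. if k = i then x k - z else 1) * (\<Prod>k=1..N. if k = j then x k - z else 1))"
      unfolding f_def biased_def by (simp only: prod.distrib)
    then show "biased N z x * ((x i - z) * (x j - z)) = (\<Prod>k=1..N. f k (x k))"
      using assms by (simp add: prod.delta)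
  qed
  also have "\<dots> = (\<Prod>k=1..N. f k (-1) + f k 1)"
    by (rule sum_configs_prod)
  also have "\<dots> = (if i = j then 1 - z\<^sup>2 else 0)"
  proof (cases "i = j")
    case True
    have "f k (-1) + f k 1 = (if k = i then 1 - z\<^sup>2 else 1)" for k
      using True by (simp add: f_def field_simps power2_eq_square)
    then show ?thesis using True assms by (simp add: prod.delta)
  next
    case False
    have "f i (-1) + f i 1 = 0"
      using False by (simp add: f_def field_simps)
    then show ?thesis using False assms by (auto intro!: prod_zero bexI[of _ i])
  qed
  finally show ?thesis .
qed

lemma biased_variance:
  assumes "N \<ge> 1"
  shows "(\<Sum>x\<in>configs N. biased N z x * (real N * (mean_spin N x - z)\<^sup>2)) = 1 - z\<^sup>2"
proof -
  have sq: "real N * (real N * (mean_spin N x - z)\<^sup>2) = (\<Sum>i=1..N. \<Sum>j=1..N. (x i - z) * (x j - z))" for x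
  proof -
    have "real N * (mean_spin N x - z) = (\<Sum>i=1..N. x i - z)"
      using assms by (simp add: mean_spin_def sum_subtractf field_simps)
    then have "(\<Sum>i=1..N. x i - z) * (\<Sum>j=1..N. x j - z) = (real N * (mean_spin N x - z))\<^sup>2"
      by (simp add: power2_eq_square)
    then show ?thesis by (simp add: sum_product power2_eq_square)
  qed
  have "real N * (\<Sum>x\<in>configs N. biased N z x * (real N * (mean_spin N x - z)\<^sup>2))
      = (\<Sum>x\<in>configs N. biased N z x * (real N * (real N * (mean_spin N x - z)\<^sup>2)))"
    by (simp add: sum_distrib_left mult_ac)
  also have "\<dots> = (\<Sum>x\<in>configs N. \<Sum>i=1..N. \<Sum>j=1..N. biased N z x * ((x i - z) * (x j - z)))"
    by (simp only: sq sum_distrib_left)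
  also have "\<dots> = (\<Sum>i=1..N. \<Sum>x\<in>configs N. \<Sum>j=1..N. biased N z x * ((x i - z) * (x j - z)))"
    by (rule sum.swap)
  also have "\<dots> = (\<Sum>i=1..N. \<Sum>j=1..N. \<Sum>x\<in>configs N. biased N z x * ((x i - z) * (x j - z)))"
    by (intro sum.cong refl sum.swap)
  also have "\<dots> = (\<Sum>i=1..N. \<Sum>j=1..N. if i = j then 1 - z\<^sup>2 else 0)"
    by (intro sum.cong refl biased_covariance) auto
  also have "\<dots> = real N * (1 - z\<^sup>2)"
    by simp
  finally show ?thesis using assms by simp
qed

text \<open>Chebyshev: the rescaled squared deviation has expectation \<open>1 - z^2\<close>, at
  most 1, so it exceeds 2 with probability at most 1/2.\<close>

lemma biased_concentration:
  assumes "N \<ge> 1" "\<bar>z\<bar> \<le> 1"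
  shows "(\<Sum>x\<in>{x \<in> configs N. real N * (mean_spin N x - z)\<^sup>2 \<le> 2}. biased N z x) \<ge> 1/2"
proof -
  let ?v = "\<lambda>x. real N * (mean_spin N x - z)\<^sup>2"
  have "1 = (\<Sum>x\<in>configs N. biased N z x)"
    by (simp add: sum_biased)
  also have "\<dots> \<le> (\<Sum>x\<in>configs N. (if ?v x \<le> 2 then biased N z x else 0) + biased N z x * ?v x / 2)"
  proof (rule sum_mono)
    fix x assume x: "x \<in> configs N"
    have b: "0 \<le> biased N z x" using biased_nonneg[OF x assms(2)] .
    have "biased N z x * 2 \<le> biased N z x * ?v x" if "\<not> ?v x \<le> 2"
      using b that by (intro mult_left_mono) auto
    then show "biased N z x \<le> (if ?v x \<le> 2 then biased N z x else 0) + biased N z x * ?v x / 2"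
      using b by auto
  qed
  also have "\<dots> = (\<Sum>x\<in>{x \<in> configs N. ?v x \<le> 2}. biased N z x) + (1 - z\<^sup>2) / 2"
    using biased_variance[OF assms(1), of z]
    by (simp add: sum.distrib sum.inter_filter flip: sum_divide_distrib)
  finally have "1 \<le> (\<Sum>x\<in>{x \<in> configs N. ?v x \<le> 2}. biased N z x) + (1 - z\<^sup>2) / 2" .
  moreover have "0 \<le> z\<^sup>2" by simp
  ultimately show ?thesis by argo
qed

text \<open>Positivity is asked only at the spins that occur in \<open>x\<close>, so that
  \<open>z\<close> may be 1 or -1 if all spins equal \<open>z\<close>.\<close>

lemma biased_eq_exp:
  assumes "N \<ge> 1" "x \<in> configs N" "\<And>i. i \<in> {1..N} \<Longrightarrow> 1 + z * x i > 0"
  shows "biased N z x = exp (real N * cross_entropy (mean_spin N x) z) / 2 ^ N"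
proof -
  \<comment> \<open>One of the two coefficients is 1 and the other 0, so only the logarithm of a
    positive number survives.\<close>
  have "1 + z * x i = exp ((1 + x i) / 2 * ln (1 + z) + (1 - x i) / 2 * ln (1 - z))"
    if "i \<in> {1..N}" for i
    using configs_cases[OF assms(2) that] assms(3)[OF that] by auto
  then have "(\<Prod>i=1..N. 1 + z * x i)
      = (\<Prod>i=1..N. exp ((1 + x i) / 2 * ln (1 + z) + (1 - x i) / 2 * ln (1 - z)))"
    by (intro prod.cong) auto
  also have "\<dots> = exp (\<Sum>i=1..N. (1 + x i) / 2 * ln (1 + z) + (1 - x i) / 2 * ln (1 - z))"
    by (simp add: exp_sum)
  also have "(\<Sum>i=1..N. (1 + x i) / 2 * ln (1 + z) + (1 - x i) / 2 * ln (1 - z))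
      = (\<Sum>i=1..N. 1 + x i) / 2 * ln (1 + z) + (\<Sum>i=1..N. 1 - x i) / 2 * ln (1 - z)"
    by (simp only: sum.distrib flip: sum_distrib_right sum_divide_distrib)
  also have "\<dots> = real N * cross_entropy (mean_spin N x) z"
    using assms(1) by (simp add: cross_entropy_def mean_spin_def sum.distrib sum_subtractf field_simps)
  finally show ?thesis
    unfolding biased_def by (simp add: prod_dividef)
qed

text \<open>Multiplied by \<open>N\<close> this is the sum of \<open>1 + x j * x i\<close> over
  \<open>j\<close>, whose terms are nonnegative and equal 2 at \<open>j = i\<close>. It makes
  \<open>z = mean_spin N x\<close> admissible in \<open>biased_eq_exp\<close>, even for constant
  configurations.\<close>

lemma one_plus_mean_spin_pos:
  assumes "x \<in> configs N" "i \<in> {1..N}"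
  shows "1 + mean_spin N x * x i > 0"
proof -
  have "0 < 1 + x i * x i" using configs_cases[OF assms] by auto
  also have "1 + x i * x i \<le> (\<Sum>j=1..N. 1 + x j * x i)"
  proof (rule member_le_sum[where f="\<lambda>j. 1 + x j * x i"])
    fix j assume "j \<in> {1..N} - {i}"
    then show "0 \<le> 1 + x j * x i"
      using configs_cases[OF assms] configs_cases[OF assms(1), of j] by auto
  qed (use assms in auto)
  also have "\<dots> = real N * (1 + mean_spin N x * x i)"
    using assms by (simp add: mean_spin_def sum.distrib field_simps sum_distrib_left)
  finally show ?thesis by (simp add: zero_less_mult_iff)
qed

lemma abs_mean_spin_le:
  assumes "x \<in> configs N" "N \<ge> 1"
  shows "\<bar>mean_spin N x\<bar> \<le> 1"
proof -
  have "\<bar>\<Sum>i=1..N. x i\<bar> \<le> (\<Sum>i=1..N. \<bar>x i\<bar>)" by (rule sum_abs)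
  also have "\<dots> \<le> (\<Sum>i=1..N. 1)"
    using configs_cases[OF assms(1)] by (intro sum_mono) force
  finally show ?thesis using assms(2) by (simp add: mean_spin_def field_simps abs_le_iff)
qed

text \<open>The magnetization is determined by the number of spins equal to 1.\<close>

lemma card_mean_spin_le: "card (mean_spin N ` configs N) \<le> N + 1"
proof -
  have "mean_spin N ` configs N \<subseteq> (\<lambda>k. (2 * real k - real N) / real N) ` {0..N}"
  proof
    fix y assume "y \<in> mean_spin N ` configs N"
    then obtain x where x: "x \<in> configs N" "y = mean_spin N x" by auto
    let ?k = "card {i\<in>{1..N}. x i = 1}"
    have "(\<Sum>i=1..N. x i) = (\<Sum>i=1..N. 2 * (if x i = 1 then 1 else 0) - 1)"
      using configs_cases[OF x(1)] by (intro sum.cong) auto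
    also have "\<dots> = 2 * real ?k - real N"
      by (simp only: sum_subtractf flip: sum_distrib_left) (simp flip: sum.inter_filter)
    finally have "y = (2 * real ?k - real N) / real N" by (simp add: x(2) mean_spin_def)
    moreover have "?k \<le> N"
    proof -
      have "?k \<le> card {1..N}" by (intro card_mono) auto
      then show ?thesis by simp
    qed
    ultimately show "y \<in> (\<lambda>k. (2 * real k - real N) / real N) ` {0..N}" by auto
  qed
  then have "card (mean_spin N ` configs N) \<le> card {0..N}"
    using surj_card_le[of "{0..N}"] by auto
  then show ?thesis by simp
qed

text \<open>The left side is the relative entropy of the spin law with mean \<open>y\<close> with
  respect to that with mean \<open>z\<close>; the right side is their chi-square divergence, and
  \<open>ln t \<le> t - 1\<close> compares the two.\<close>

lemma cross_entropy_diff_le: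
  assumes "\<bar>y\<bar> \<le> 1" "\<bar>z\<bar> < 1"
  shows "cross_entropy y y - cross_entropy y z \<le> (y - z)\<^sup>2 / (1 - z\<^sup>2)"
proof -
  \<comment> \<open>The case \<open>u = 0\<close> occurs at \<open>y = 1\<close> and
    \<open>y = -1\<close>, where both sides vanish.\<close>
  have gen: "u * (ln u - ln v) \<le> u * ((u - v) / v)" if "u \<ge> 0" "v > 0" for u v :: real
  proof (cases "u = 0")
    case False
    then have "u > 0" using that by simp
    then have "ln u - ln v = ln (u / v)" using that by (simp add: ln_div)
    also have "\<dots> \<le> u / v - 1" using \<open>u > 0\<close> that by (intro ln_le_minus_one) simp
    also have "\<dots> = (u - v) / v" using that by (simp add: field_simps)
    finally show ?thesis using that by (intro mult_left_mono) auto
  qed simp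
  have z: "1 + z > 0" "1 - z > 0" using assms by auto
  have "cross_entropy y y - cross_entropy y z
      = ((1 + y) * (ln (1 + y) - ln (1 + z)) + (1 - y) * (ln (1 - y) - ln (1 - z))) / 2"
    by (simp add: cross_entropy_def field_simps)
  also have "\<dots> \<le> ((1 + y) * (((1 + y) - (1 + z)) / (1 + z)) + (1 - y) * (((1 - y) - (1 - z)) / (1 - z))) / 2"
    using assms z by (intro divide_right_mono add_mono gen) auto
  also have "\<dots> = (y - z)\<^sup>2 / ((1 + z) * (1 - z))"
    using z by (simp add: divide_simps) (simp add: algebra_simps power2_eq_square)
  also have "(1 + z) * (1 - z) = 1 - z\<^sup>2" by (simp add: algebra_simps power2_eq_square)
  finally show ?thesis .
qed

text \<open>Each \<open>biased N (z j)\<close> has total mass 1, so a function dominated by the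
  mixture sums to at most the total weight. This bounds the partition function without estimates of
  binomial coefficients.\<close>

lemma sum_le_mixture_weights:
  assumes "finite J" "A \<subseteq> configs N"
    and J: "\<And>j. j \<in> J \<Longrightarrow> 0 \<le> w j \<and> \<bar>z j\<bar> \<le> 1"
    and dom: "\<And>x. x \<in> A \<Longrightarrow> \<exists>j\<in>J. f x \<le> w j * biased N (z j) x"
  shows "sum f A \<le> sum w J"
proof -
  have "sum f A \<le> (\<Sum>x\<in>A. \<Sum>j\<in>J. w j * biased N (z j) x)"
  proof (rule sum_mono)
    fix x assume x: "x \<in> A"
    then obtain j where j: "j \<in> J" "f x \<le> w j * biased N (z j) x" using dom by blast
    have "w j * biased N (z j) x \<le> (\<Sum>j\<in>J. w j * biased N (z j) x)"
      using assms x j by (intro member_le_sum) (auto intro!: mult_nonneg_nonneg biased_nonneg)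
    with j show "f x \<le> (\<Sum>j\<in>J. w j * biased N (z j) x)" by simp
  qed
  also have "\<dots> \<le> (\<Sum>x\<in>configs N. \<Sum>j\<in>J. w j * biased N (z j) x)"
    using assms by (intro sum_mono2 sum_nonneg mult_nonneg_nonneg biased_nonneg) auto
  also have "\<dots> = (\<Sum>j\<in>J. \<Sum>x\<in>configs N. w j * biased N (z j) x)"
    by (rule sum.swap)
  also have "\<dots> = sum w J"
    by (simp add: sum_biased flip: sum_distrib_left)
  finally show ?thesis .
qed

subsection \<open>The rate function\<close>

lemma H_eq: "H \<beta> p x = \<beta> * x ^ p - cross_entropy x x"
  by (simp add: H_def cross_entropy_def field_simps)

lemma cross_entropy_minus: "cross_entropy (- x) (- x) = cross_entropy x x"
  by (simp add: cross_entropy_def field_simps)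

text \<open>The slope is artanh \<open>z\<close>. At \<open>z = m\<close>, criticality identifies it
  with the slope of the power term of \<open>H\<close>, which removes the first-order terms in
  \<open>exponent_ge\<close>.\<close>

lemma cross_entropy_affine:
  "cross_entropy y z = cross_entropy z z + (y - z) * ((ln (1 + z) - ln (1 - z)) / 2)"
  by (simp add: cross_entropy_def field_simps)

section \<open>Derivatives and continuity of \<open>H\<close>, and two elementary
  inequalities\<close>

definition dH :: "real \<Rightarrow> nat \<Rightarrow> real \<Rightarrow> real" where
  "dH \<beta> p x = \<beta> * real p * x ^ (p - 1) - (ln (1 + x) - ln (1 - x)) / 2"

definition d2H :: "real \<Rightarrow> nat \<Rightarrow> real \<Rightarrow> real" where
  "d2H \<beta> p x = \<beta> * real p * real (p - 1) * x ^ (p - 2) - 1 / (1 - x\<^sup>2)"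

definition d3H :: "real \<Rightarrow> nat \<Rightarrow> real \<Rightarrow> real" where
  "d3H \<beta> p x = \<beta> * real p * real (p - 1) * real (p - 2) * x ^ (p - 3) - 2 * x / (1 - x\<^sup>2)\<^sup>2"

lemma one_minus_square_pos: "\<bar>x\<bar> < 1 \<Longrightarrow> 1 - x\<^sup>2 > (0::real)"
  by (simp add: abs_square_less_1)

lemma DERIV_H: "\<bar>x\<bar> < 1 \<Longrightarrow> (H \<beta> p has_real_derivative dH \<beta> p x) (at x)"
proof -
  assume x: "\<bar>x\<bar> < 1"
  have 1: "((\<lambda>x. (1 + x) * ln (1 + x)) has_real_derivative ln (1 + x) + 1) (at x)"
    using x by (auto intro!: derivative_eq_intros)
  have 2: "((\<lambda>x. (1 - x) * ln (1 - x)) has_real_derivative - ln (1 - x) - 1) (at x)"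
    using x by (auto intro!: derivative_eq_intros)
  have "(H \<beta> p has_real_derivative \<beta> * (real p * x ^ (p - Suc 0)) -
      1 / 2 * ((ln (1 + x) + 1) + (- ln (1 - x) - 1))) (at x)"
    unfolding H_def[abs_def] by (intro DERIV_diff DERIV_cmult DERIV_add DERIV_pow 1 2)
  then show ?thesis by (simp add: dH_def field_simps)
qed

lemma DERIV_dH: "\<bar>x\<bar> < 1 \<Longrightarrow> (dH \<beta> p has_real_derivative d2H \<beta> p x) (at x)"
proof -
  assume x: "\<bar>x\<bar> < 1"
  then have pos: "1 + x > 0" "1 - x > 0" by auto
  have inv: "1 / (1 - x\<^sup>2) = (1 / (1 + x) + 1 / (1 - x)) / 2"
    using x one_minus_square_pos[OF x] pos
    by (simp add: divide_simps) (simp add: algebra_simps power2_eq_square)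
  have ln: "((\<lambda>x. (ln (1 + x) - ln (1 - x)) / 2) has_real_derivative 1 / (1 - x\<^sup>2)) (at x)"
    unfolding inv using pos by (auto intro!: derivative_eq_intros)
  have "(dH \<beta> p has_real_derivative
      \<beta> * real p * (real (p - 1) * x ^ (p - 1 - Suc 0)) - 1 / (1 - x\<^sup>2)) (at x)"
    unfolding dH_def[abs_def] by (intro DERIV_diff DERIV_cmult DERIV_pow ln)
  then show ?thesis by (simp add: d2H_def numeral_2_eq_2 mult.assoc)
qed

lemma DERIV_d2H: "\<bar>x\<bar> < 1 \<Longrightarrow> (d2H \<beta> p has_real_derivative d3H \<beta> p x) (at x)"
  unfolding d2H_def[abs_def] d3H_def using one_minus_square_pos[of x]
  by (auto intro!: derivative_eq_intros simp: numeral_2_eq_2 numeral_3_eq_3 field_simps)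

text \<open>At 0 the value \<open>0 * ln 0 = 0\<close> agrees with the limit from the right; this
  gives continuity of \<open>H\<close> up to 1.\<close>

lemma continuous_on_x_ln_x: "continuous_on {0..} (\<lambda>x::real. x * ln x)"
proof (rule continuous_on_eq_continuous_within[THEN iffD2], intro ballI)
  fix x :: real assume "x \<in> {0..}"
  show "continuous (at x within {0..}) (\<lambda>x. x * ln x)"
  proof (cases "x = 0")
    case True
    have "((\<lambda>x::real. x * ln x) \<longlongrightarrow> 0) (at_right 0)" by real_asymp
    then show ?thesis using True
      by (simp add: continuous_within at_within_Ici_at_right)
  next
    case False
    then show ?thesis using \<open>x \<in> {0..}\<close>
      by (intro continuous_intros) auto
  qed
qed

lemma continuous_on_H: "continuous_on {0..1} (H \<beta> p)"
proof -
  have 1: "continuous_on {0..1} (\<lambda>x::real. (1 + x) * ln (1 + x))"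
    by (rule continuous_on_compose2[OF continuous_on_x_ln_x]) (auto intro!: continuous_intros)
  have 2: "continuous_on {0..1} (\<lambda>x::real. (1 - x) * ln (1 - x))"
    by (rule continuous_on_compose2[OF continuous_on_x_ln_x]) (auto intro!: continuous_intros)
  show ?thesis
    unfolding H_def[abs_def]
    by (intro continuous_on_diff continuous_on_mult_left continuous_on_add continuous_on_power
        continuous_on_id 1 2)
qed

text \<open>The derivative of artanh \<open>t - t\<close> is \<open>t^2 / (1 - t^2)\<close>, which
  is nonnegative.\<close>

lemma ln_ratio_ge:
  assumes "0 \<le> x" "x < 1"
  shows "(ln (1 + x) - ln (1 - x)) / 2 \<ge> (x::real)"
proof -
  let ?f = "\<lambda>x::real. (ln (1 + x) - ln (1 - x)) / 2 - x"
  have "?f 0 \<le> ?f x"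
  proof (rule DERIV_nonneg_imp_nondecreasing[OF assms(1)])
    fix t assume t: "0 \<le> t" "t \<le> x"
    then have "(?f has_real_derivative t\<^sup>2 / (1 - t\<^sup>2)) (at t)"
      using assms one_minus_square_pos[of t]
      by (auto intro!: derivative_eq_intros simp: divide_simps)
        (auto simp: algebra_simps power2_eq_square)
    moreover have "t\<^sup>2 / (1 - t\<^sup>2) \<ge> 0"
      using t assms one_minus_square_pos[of t] by simp
    ultimately show "\<exists>y. (?f has_real_derivative y) (at t) \<and> 0 \<le> y" by blast
  qed
  then show ?thesis by simp
qed

lemma abs_power_tangent_le:
  fixes x m :: real
  assumes "\<bar>x\<bar> \<le> 1" "\<bar>m\<bar> \<le> 1"
  shows "\<bar>x ^ p - m ^ p - real p * m ^ (p - 1) * (x - m)\<bar> \<le> (real p)\<^sup>2 * (x - m)\<^sup>2"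
proof (induction p)
  case (Suc p)
  let ?r = "\<lambda>p. x ^ p - m ^ p - real p * m ^ (p - 1) * (x - m)"
  \<comment> \<open>A recursion for the Taylor remainder; the bound closes because
    \<open>p^2 + p \<le> (p + 1)^2\<close>.\<close>
  have eq: "?r (Suc p) = x * ?r p + real p * m ^ (p - 1) * (x - m)\<^sup>2"
    by (cases p) (simp_all add: algebra_simps power2_eq_square)
  have "\<bar>x * ?r p\<bar> \<le> 1 * \<bar>?r p\<bar>"
    unfolding abs_mult using assms by (intro mult_right_mono) auto
  moreover have "\<bar>real p * m ^ (p - 1) * (x - m)\<^sup>2\<bar> \<le> real p * 1 * (x - m)\<^sup>2"
    unfolding abs_mult abs_power2 using assms
    by (intro mult_right_mono mult_mono) (auto simp: power_abs power_le_one)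
  ultimately have "\<bar>?r (Suc p)\<bar> \<le> (real p)\<^sup>2 * (x - m)\<^sup>2 + real p * (x - m)\<^sup>2"
    using Suc abs_triangle_ineq[of "x * ?r p" "real p * m ^ (p - 1) * (x - m)\<^sup>2"]
    unfolding eq by linarith
  also have "\<dots> = ((real p)\<^sup>2 + real p) * (x - m)\<^sup>2" by (simp add: algebra_simps)
  also have "\<dots> \<le> (real (Suc p))\<^sup>2 * (x - m)\<^sup>2"
    by (rule mult_right_mono) (simp add: power2_eq_square algebra_simps, simp)
  finally show ?case .
qed simp

section \<open>Criticality and nondegeneracy of \<open>H\<close> at its maximizer\<close>

locale maximizer =
  fixes \<beta> :: real and p :: nat and m :: real
  assumes m: "0 \<le> m" "m < 1"
    and Theta: "(\<beta>, p) \<in> Theta m"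
begin

lemma beta_pos: "\<beta> > 0" and p_ge: "p \<ge> 3"
  using Theta by (auto simp: Theta_def)

lemma H_less:
  assumes "x \<in> {0..1}" "x \<noteq> m"
  shows "H \<beta> p x < H \<beta> p m"
proof (rule ccontr)
  have max: "is_arg_max (H \<beta> p) (\<lambda>y. y \<in> {0..1}) x \<longleftrightarrow> x = m" for x
    using Theta unfolding Theta_def unique_global_maximizer_def by blast
  assume "\<not> H \<beta> p x < H \<beta> p m"
  then have "is_arg_max (H \<beta> p) (\<lambda>y. y \<in> {0..1}) x"
    using max[of m] assms unfolding is_arg_max_def by force
  then show False using max assms by blast
qed

text \<open>For \<open>m > 0\<close> the maximizer is interior. At \<open>m = 0\<close>, an endpoint
  of the interval, the derivative vanishes because \<open>p - 1 > 0\<close>.\<close>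

lemma dH_eq_0: "dH \<beta> p m = 0"
proof (cases "m = 0")
  case True
  then show ?thesis using p_ge by (simp add: dH_def)
next
  case False
  show ?thesis
  proof (rule DERIV_local_max)
    show "(H \<beta> p has_real_derivative dH \<beta> p m) (at m)" using m by (intro DERIV_H) auto
    show "0 < min m (1 - m)" using m False by auto
    show "\<forall>y. \<bar>m - y\<bar> < min m (1 - m) \<longrightarrow> H \<beta> p y \<le> H \<beta> p m"
    proof (intro allI impI)
      fix y assume "\<bar>m - y\<bar> < min m (1 - m)"
      then have "y \<in> {0..1}" by auto
      then show "H \<beta> p y \<le> H \<beta> p m" using H_less[of y] by (cases "y = m") auto
    qed
  qed
qed

text \<open>With \<open>p = n + 3\<close>, criticality and \<open>artanh m \<ge> m\<close> turn \<open>d2H = 0\<close> into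
  \<open>(n + 2) (1 - m\<^sup>2) \<le> 1\<close>, while \<open>d3H\<close> has the sign of \<open>(n + 3) (1 - m\<^sup>2) - 2\<close>.\<close>

lemma d3H_neg_if_degenerate:
  assumes "m \<noteq> 0" and deg: "d2H \<beta> p m = 0"
  shows "d3H \<beta> p m < 0"
proof -
  obtain n where p: "p = Suc (Suc (Suc n))"
    using p_ge that[of "p - 3"] by simp
  let ?u = "1 - m\<^sup>2"
  let ?b = "\<beta> * real p * m ^ n"
  have m0: "m > 0" using assms m by simp
  have u: "?u > 0" using m by (intro one_minus_square_pos) auto
  have "?b * m * m = (ln (1 + m) - ln (1 - m)) / 2"
    using dH_eq_0 by (simp add: dH_def p mult_ac)
  then have "?b * m * m \<ge> m" using ln_ratio_ge[of m] m by simp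
  then have b: "?b * m \<ge> 1" using m0 by simp
  have "?b * m * (real n + 2) = 1 / ?u"
    using deg by (simp add: d2H_def p algebra_simps)
  then have bu: "?b * m * (real n + 2) * ?u = 1"
    using u by (simp only:) simp
  have "1 * ((real n + 2) * ?u) \<le> ?b * m * ((real n + 2) * ?u)"
    using b u by (intro mult_right_mono) auto
  also have "\<dots> = 1" using bu by (simp only: mult.assoc)
  finally have le: "(real n + 2) * ?u \<le> 1" by simp
  have "m * v\<^sup>2 * d3H \<beta> p m = (?b * m * (real n + 2) * v) * (real n + 1) * v - 2 * m\<^sup>2"
    if "v = ?u" for v
  proof -
    have "real (p - 1) = real n + 2" "real (p - 2) = real n + 1" "p - 3 = n"
      using p by auto
    then have *: "d3H \<beta> p m = \<beta> * real p * (real n + 2) * (real n + 1) * m ^ n - 2 * m / v\<^sup>2"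
      unfolding d3H_def that by (simp add: add.commute)
    have "v > 0" using u that by simp
    then show ?thesis unfolding * by (simp add: field_simps power2_eq_square)
  qed
  then have "m * ?u\<^sup>2 * d3H \<beta> p m = (?b * m * (real n + 2) * ?u) * (real n + 1) * ?u - 2 * m\<^sup>2"
    by blast
  also have "\<dots> = (real n + 3) * ?u - 2" unfolding bu by (simp add: algebra_simps)
  also have "\<dots> < 0"
  proof -
    \<comment> \<open>The inequality is scaled by \<open>n + 2\<close> so that \<open>le\<close>
      applies; what remains is \<open>n + 3 < 2 * (n + 2)\<close>.\<close>
    have "(real n + 2) * ((real n + 3) * ?u) \<le> (real n + 3) * 1"
      using mult_left_mono[OF le, of "real n + 3"] by (simp add: mult_ac)
    also have "\<dots> < (real n + 2) * 2" by simp
    finally show ?thesis by (simp only: mult_less_cancel_left) simp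
  qed
  finally show ?thesis using m0 u by (simp add: mult_less_0_iff zero_less_mult_iff)
qed

text \<open>At \<open>m = 0\<close> the value is -1. For \<open>m > 0\<close>, a nonnegative second
  derivative would make \<open>H\<close> strictly decreasing on an interval ending at
  \<open>m\<close>, against maximality.\<close>

lemma d2H_neg: "d2H \<beta> p m < 0"
proof (cases "m = 0")
  case True
  then show ?thesis using p_ge by (simp add: d2H_def power_0_left)
next
  case False
  then have m0: "m > 0" using m by simp
  have am: "\<bar>m\<bar> < 1" using m by simp
  show ?thesis
  proof (rule ccontr)
    assume neg: "\<not> d2H \<beta> p m < 0"
    have "\<exists>d>0. d \<le> m \<and> (\<forall>h>0. h < d \<longrightarrow> dH \<beta> p (m - h) < 0)"
    proof (cases "d2H \<beta> p m = 0")
      case False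
      then have "d2H \<beta> p m > 0" using neg by simp
      from DERIV_pos_inc_left[OF DERIV_dH[OF am] this]
      obtain d where "d > 0" "\<forall>h>0. h < d \<longrightarrow> dH \<beta> p (m - h) < dH \<beta> p m" by blast
      then show ?thesis using dH_eq_0 m0 by (intro exI[of _ "min d m"]) auto
    next
      case True
      \<comment> \<open>In the degenerate case the negative third derivative makes
        \<open>d2H\<close> positive just to the left of \<open>m\<close>, so \<open>dH\<close>
        increases there to its zero at \<open>m\<close>.\<close>
      from DERIV_neg_dec_left[OF DERIV_d2H[OF am] d3H_neg_if_degenerate[OF \<open>m \<noteq> 0\<close> True]]
      obtain d where d: "d > 0" "\<forall>h>0. h < d \<longrightarrow> d2H \<beta> p m < d2H \<beta> p (m - h)" by blast
      have "dH \<beta> p (m - h) < 0" if h: "0 < h" "h < min d m" for h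
      proof -
        have "dH \<beta> p (m - h) < dH \<beta> p m"
        proof (rule DERIV_pos_imp_increasing_open[of "m - h" m "dH \<beta> p"])
          fix x assume x: "m - h < x" "x < m"
          have "d2H \<beta> p x > 0" using d(2)[rule_format, of "m - x"] x h True by auto
          moreover have "(dH \<beta> p has_real_derivative d2H \<beta> p x) (at x)"
            using x h m by (intro DERIV_dH) auto
          ultimately show "\<exists>y. (dH \<beta> p has_real_derivative y) (at x) \<and> 0 < y" by blast
        next
          show "continuous_on {m - h..m} (dH \<beta> p)"
            using h m by (intro DERIV_atLeastAtMost_imp_continuous_on) (auto intro!: exI DERIV_dH)
        qed (use h in auto)
        then show ?thesis using dH_eq_0 by simp
      qed
      then show ?thesis using d m0 by (intro exI[of _ "min d m"]) auto
    qed
    then obtain d where d: "d > 0" "d \<le> m" "\<forall>h>0. h < d \<longrightarrow> dH \<beta> p (m - h) < 0" by blast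
    have "H \<beta> p m < H \<beta> p (m - d / 2)"
    proof (rule DERIV_neg_imp_decreasing_open[of "m - d / 2" m "H \<beta> p"])
      fix x assume x: "m - d / 2 < x" "x < m"
      have "dH \<beta> p x < 0" using d(3)[rule_format, of "m - x"] x d by auto
      moreover have "(H \<beta> p has_real_derivative dH \<beta> p x) (at x)"
        using x d m by (intro DERIV_H) auto
      ultimately show "\<exists>y. (H \<beta> p has_real_derivative y) (at x) \<and> y < 0" by blast
    next
      show "continuous_on {m - d / 2..m} (H \<beta> p)"
        using d m by (intro continuous_on_subset[OF continuous_on_H]) auto
    qed (use d in auto)
    moreover have "H \<beta> p (m - d / 2) < H \<beta> p m" using d m by (intro H_less) auto
    ultimately show False by simp
  qed
qed

lemma H_quadratic_near:
  obtains c d where "c > 0" "d > 0"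
    "\<And>x. 0 \<le> x \<Longrightarrow> x < 1 \<Longrightarrow> \<bar>x - m\<bar> < d \<Longrightarrow> H \<beta> p x \<le> H \<beta> p m - c * (x - m)\<^sup>2"
proof -
  have "isCont (d2H \<beta> p) m"
    using m by (intro DERIV_isCont[OF DERIV_d2H]) auto
  moreover have "- d2H \<beta> p m / 2 > 0" using d2H_neg by simp
  ultimately obtain d where d: "d > 0"
      "\<And>x. dist x m < d \<Longrightarrow> dist (d2H \<beta> p x) (d2H \<beta> p m) < - d2H \<beta> p m / 2"
    unfolding continuous_at_eps_delta by blast
  show ?thesis
  proof (rule that)
    \<comment> \<open>One factor 1/2 is lost to continuity of \<open>d2H\<close>, the other is the
      Taylor coefficient.\<close>
    show "- d2H \<beta> p m / 4 > 0" "d > 0" using d2H_neg d by auto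
    fix x assume x: "0 \<le> x" "x < 1" "\<bar>x - m\<bar> < d"
    show "H \<beta> p x \<le> H \<beta> p m - - d2H \<beta> p m / 4 * (x - m)\<^sup>2"
    proof (cases "x = m")
      case False
      define diff where "diff k = (if k = 0 then H \<beta> p else if k = 1 then dH \<beta> p else d2H \<beta> p)"
        for k :: nat
      have "\<exists>t. (if x < m then x < t \<and> t < m else m < t \<and> t < x) \<and>
          H \<beta> p x = (\<Sum>k<2. diff k m / fact k * (x - m) ^ k) + diff 2 t / fact 2 * (x - m) ^ 2"
      proof (rule Taylor[where a = "min x m" and b = "max x m"])
        show "\<forall>k t. k < 2 \<and> min x m \<le> t \<and> t \<le> max x m \<longrightarrow>
            (diff k has_real_derivative diff (Suc k) t) (at t)"
        proof (intro allI impI)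
          fix k t assume *: "k < (2::nat) \<and> min x m \<le> t \<and> t \<le> max x m"
          then have "\<bar>t\<bar> < 1" using x m by auto
          moreover have "k = 0 \<or> k = 1" using * by auto
          ultimately show "(diff k has_real_derivative diff (Suc k) t) (at t)"
            by (auto simp: diff_def intro: DERIV_H DERIV_dH)
        qed
      qed (use False in \<open>auto simp: diff_def\<close>)
      then obtain t where t: "if x < m then x < t \<and> t < m else m < t \<and> t < x"
        "H \<beta> p x = H \<beta> p m + d2H \<beta> p t / 2 * (x - m)\<^sup>2"
        by (auto simp: diff_def numeral_2_eq_2 dH_eq_0)
      have "dist t m < d" using t(1) x by (auto simp: dist_real_def split: if_splits)
      then have "d2H \<beta> p t \<le> d2H \<beta> p m / 2"
        using d(2)[of t] by (auto simp: dist_real_def abs_less_iff)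
      then have "d2H \<beta> p t / 2 * (x - m)\<^sup>2 \<le> d2H \<beta> p m / 2 / 2 * (x - m)\<^sup>2"
        by (intro mult_right_mono) auto
      then show ?thesis using t(2) by simp
    qed simp
  qed
qed

text \<open>Near \<open>m\<close> the Taylor bound applies; on the compact rest of the interval
  \<open>H\<close> stays below its maximum by a fixed gap, and \<open>(x - m)^2\<close> is at most
  1.\<close>

lemma H_quadratic:
  obtains c where "c > 0" "\<And>x. x \<in> {0..1} \<Longrightarrow> H \<beta> p x \<le> H \<beta> p m - c * (x - m)\<^sup>2"
proof -
  obtain c d where c: "c > 0" and d: "d > 0"
    and near: "\<And>x. 0 \<le> x \<Longrightarrow> x < 1 \<Longrightarrow> \<bar>x - m\<bar> < d \<Longrightarrow> H \<beta> p x \<le> H \<beta> p m - c * (x - m)\<^sup>2"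
    using H_quadratic_near by blast
  define d' where "d' = min d (1 - m)"
  have d': "d' > 0" using d m by (simp add: d'_def)
  define S where "S = {0..1} - ball m d'"
  have S: "compact S" unfolding S_def by (intro compact_diff) auto
  have "1 \<in> S" using m by (auto simp: S_def d'_def dist_real_def)
  moreover have "continuous_on S (H \<beta> p)"
    by (rule continuous_on_subset[OF continuous_on_H]) (auto simp: S_def)
  ultimately obtain x0 where x0: "x0 \<in> S" "\<And>x. x \<in> S \<Longrightarrow> H \<beta> p x \<le> H \<beta> p x0"
    using continuous_attains_sup[OF S] by blast
  have gap: "H \<beta> p x0 < H \<beta> p m"
    using x0(1) d' by (intro H_less) (auto simp: S_def)
  show ?thesis
  proof (rule that)
    let ?c = "min c (H \<beta> p m - H \<beta> p x0)"
    show "?c > 0" using c gap by simp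
    fix x :: real assume x: "x \<in> {0..1}"
    show "H \<beta> p x \<le> H \<beta> p m - ?c * (x - m)\<^sup>2"
    proof (cases "x \<in> S")
      case True
      have "(x - m)\<^sup>2 \<le> 1" using x m by (auto simp: abs_square_le_1)
      then have "?c * (x - m)\<^sup>2 \<le> (H \<beta> p m - H \<beta> p x0) * 1"
        using c gap by (intro mult_mono) auto
      then show ?thesis using x0(2)[OF True] by simp
    next
      case False
      then have "\<bar>x - m\<bar> < d'" using x by (auto simp: S_def dist_real_def)
      then have "\<bar>x - m\<bar> < d" "x < 1" by (auto simp: d'_def)
      then have "H \<beta> p x \<le> H \<beta> p m - c * (x - m)\<^sup>2" using x near by auto
      moreover have "?c * (x - m)\<^sup>2 \<le> c * (x - m)\<^sup>2" by (intro mult_right_mono) auto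
      ultimately show ?thesis by simp
    qed
  qed
qed

text \<open>Negative magnetizations reduce to positive ones, since the entropy term is even and
  \<open>y ^ p \<le> \<bar>y\<bar> ^ p\<close>. The distance of \<open>\<bar>y\<bar>\<close> from
  \<open>m\<close> allows for the second well at \<open>-m\<close> when \<open>p\<close> is
  even.\<close>

lemma exponent_quadratic:
  obtains c where "c > 0"
    "\<And>y. \<bar>y\<bar> \<le> 1 \<Longrightarrow> \<beta> * y ^ p - cross_entropy y y \<le> H \<beta> p m - c * (\<bar>y\<bar> - m)\<^sup>2"
proof -
  obtain c where c: "c > 0" "\<And>x. x \<in> {0..1} \<Longrightarrow> H \<beta> p x \<le> H \<beta> p m - c * (x - m)\<^sup>2"
    using H_quadratic by blast
  show ?thesis
  proof (rule that[OF c(1)])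
    fix y :: real assume y: "\<bar>y\<bar> \<le> 1"
    have "y ^ p \<le> \<bar>y\<bar> ^ p" by (metis abs_ge_self power_abs)
    moreover have "cross_entropy y y = cross_entropy \<bar>y\<bar> \<bar>y\<bar>"
      by (simp add: abs_if cross_entropy_minus)
    ultimately have "\<beta> * y ^ p - cross_entropy y y \<le> H \<beta> p \<bar>y\<bar>"
      using beta_pos by (simp add: H_eq)
    then show "\<beta> * y ^ p - cross_entropy y y \<le> H \<beta> p m - c * (\<bar>y\<bar> - m)\<^sup>2"
      using c(2)[of "\<bar>y\<bar>"] y by simp
  qed
qed

text \<open>At the critical point \<open>m\<close> the tangent of the power term cancels the linear
  part of \<open>cross_entropy y m\<close>, so only a quadratic error is left.\<close>

lemma exponent_ge:
  assumes "\<bar>y\<bar> \<le> 1"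
  shows "\<beta> * y ^ p \<ge> H \<beta> p m + cross_entropy y m - \<beta> * (real p)\<^sup>2 * (y - m)\<^sup>2"
proof -
  have "\<beta> * (y ^ p - m ^ p - real p * m ^ (p - 1) * (y - m)) \<ge> \<beta> * (- ((real p)\<^sup>2 * (y - m)\<^sup>2))"
    using abs_power_tangent_le[of y m p] assms m beta_pos by (intro mult_left_mono) auto
  moreover have "cross_entropy y m = cross_entropy m m + \<beta> * real p * m ^ (p - 1) * (y - m)"
    using dH_eq_0 cross_entropy_affine[of y m] by (simp add: dH_def)
  ultimately show ?thesis by (simp add: H_eq algebra_simps)
qed

subsection \<open>The partition function\<close>

text \<open>Domination of the unnormalised Gibbs weight by a mixture of product measures: a configuration
  with \<open>\<bar>y\<bar> < r\<close> is charged to the product measure whose mean \<open>\<sigma> (m + \<tau> i / sqrt N)\<close> lies between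
  \<open>\<plusminus>m\<close> and its magnetization \<open>y\<close>, at distance at most \<open>1 / sqrt N\<close> from \<open>y\<close>; the remaining ones are
  charged to the product measure with mean \<open>y\<close> itself.\<close>

lemma weight_eq:
  assumes "N \<ge> 1" "x \<in> configs N" "\<And>i. i \<in> {1..N} \<Longrightarrow> 1 + z * x i > 0"
  defines "y \<equiv> mean_spin N x"
  shows "exp (\<beta> * real N * y ^ p) / (2 ^ N * exp (real N * H \<beta> p m))
    = exp (real N * (\<beta> * y ^ p - cross_entropy y z - H \<beta> p m)) * biased N z x"
proof -
  have "biased N z x = exp (real N * cross_entropy y z) / 2 ^ N"
    unfolding y_def by (rule biased_eq_exp) fact+
  then show ?thesis by (simp add: exp_diff right_diff_distrib mult_ac)
qed

text \<open>With \<open>z = y\<close> there is no relative entropy cost, even at 1 and -1. At most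
  \<open>N + 1\<close> magnetizations occur, and the exponential gap absorbs this count.\<close>

lemma weight_far_le:
  assumes "N \<ge> 1" "c > 0" "r > m"
    and c: "\<And>y. \<bar>y\<bar> \<le> 1 \<Longrightarrow> \<beta> * y ^ p - cross_entropy y y \<le> H \<beta> p m - c * (\<bar>y\<bar> - m)\<^sup>2"
  shows "(\<Sum>x\<in>{x \<in> configs N. \<bar>mean_spin N x\<bar> \<ge> r}.
      exp (\<beta> * real N * mean_spin N x ^ p) / (2 ^ N * exp (real N * H \<beta> p m)))
    \<le> 1 + 1 / (c * (r - m)\<^sup>2)"
proof -
  define b where "b = c * (r - m)\<^sup>2"
  have b: "b > 0" using assms by (simp add: b_def)
  have "(\<Sum>x\<in>{x \<in> configs N. \<bar>mean_spin N x\<bar> \<ge> r}.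
      exp (\<beta> * real N * mean_spin N x ^ p) / (2 ^ N * exp (real N * H \<beta> p m)))
    \<le> (\<Sum>y\<in>mean_spin N ` configs N. exp (- (real N * b)))"
  proof (rule sum_le_mixture_weights[where z = "\<lambda>y. y"])
    fix x assume x: "x \<in> {x \<in> configs N. \<bar>mean_spin N x\<bar> \<ge> r}"
    define y where "y = mean_spin N x"
    have xc: "x \<in> configs N" and y: "\<bar>y\<bar> \<ge> r" "\<bar>y\<bar> \<le> 1"
      using x abs_mean_spin_le[OF _ assms(1)] by (auto simp: y_def)
    have "b \<le> c * (\<bar>y\<bar> - m)\<^sup>2"
      unfolding b_def using assms y by (intro mult_left_mono power_mono) auto
    then have "\<beta> * y ^ p - cross_entropy y y - H \<beta> p m \<le> - b" using c[OF y(2)] by simp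
    then have "exp (real N * (\<beta> * y ^ p - cross_entropy y y - H \<beta> p m)) \<le> exp (real N * - b)"
      by (intro exp_le_cancel_iff[THEN iffD2] mult_left_mono) auto
    then have "exp (\<beta> * real N * y ^ p) / (2 ^ N * exp (real N * H \<beta> p m))
        \<le> exp (real N * - b) * biased N y x"
      using weight_eq[OF assms(1) xc one_plus_mean_spin_pos[OF xc]] biased_nonneg[OF xc y(2)]
      by (simp add: y_def mult_right_mono)
    then show "\<exists>y\<in>mean_spin N ` configs N.
        exp (\<beta> * real N * mean_spin N x ^ p) / (2 ^ N * exp (real N * H \<beta> p m))
        \<le> exp (- (real N * b)) * biased N y x"
      using xc by (auto simp: y_def)
  qed (use abs_mean_spin_le[OF _ assms(1)] in auto)
  also have "\<dots> \<le> (real N + 1) * exp (- (real N * b))"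
    using card_mean_spin_le[of N] by simp
  also have "\<dots> \<le> ((1 + 1 / b) * exp (real N * b)) * exp (- (real N * b))"
  proof (rule mult_right_mono)
    \<comment> \<open>The product on the right expands to
      \<open>1 + N * b + 1 / b + N\<close>.\<close>
    have "real N + 1 \<le> (1 + 1 / b) * (1 + real N * b)"
      using b by (simp add: field_simps)
    also have "\<dots> \<le> (1 + 1 / b) * exp (real N * b)"
      using b by (intro mult_left_mono exp_ge_add_one_self) auto
    finally show "real N + 1 \<le> (1 + 1 / b) * exp (real N * b)" .
  qed simp
  also have "\<dots> = 1 + 1 / b" by (simp add: mult.assoc flip: exp_add)
  finally show ?thesis by (simp add: b_def)
qed

lemma shell_center:
  fixes y :: real
  assumes "\<bar>y\<bar> \<le> r" "m \<le> r" "r \<le> 1" "N \<ge> 1"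
  obtains \<sigma> \<tau> :: real and i :: nat where "\<sigma> \<in> {-1, 1}" "\<tau> \<in> {-1, 1}" "i \<le> N"
    "\<bar>\<sigma> * (m + \<tau> * (real i / sqrt N))\<bar> \<le> r"
    "real N * (y - \<sigma> * (m + \<tau> * (real i / sqrt N)))\<^sup>2 \<le> 1"
    "real i \<le> real N * (\<bar>y\<bar> - m)\<^sup>2 + 1"
proof -
  define \<sigma> :: real where "\<sigma> = (if y \<ge> 0 then 1 else -1)"
  define \<tau> :: real where "\<tau> = (if \<bar>y\<bar> \<ge> m then 1 else -1)"
  \<comment> \<open>The distance of \<open>\<bar>y\<bar>\<close> from \<open>m\<close> in units of
    \<open>1 / sqrt N\<close>. Rounding it down puts the center on the side of
    \<open>m\<close>.\<close>
  define D where "D = \<bar>\<bar>y\<bar> - m\<bar> * sqrt N"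
  define i where "i = nat \<lfloor>D\<rfloor>"
  have N: "sqrt N > 0" "sqrt N * sqrt N = N" using assms by auto
  have D: "D \<ge> 0" unfolding D_def by simp
  have i: "real i \<le> D" "D \<le> real i + 1"
    unfolding i_def using D by linarith+
  let ?z = "m + \<tau> * (real i / sqrt N)"
  have y: "\<bar>y\<bar> = m + \<tau> * (D / sqrt N)" "y = \<sigma> * \<bar>y\<bar>"
    using N by (auto simp: \<tau>_def D_def \<sigma>_def)
  \<comment> \<open>A center between \<open>m\<close> and \<open>\<bar>y\<bar>\<close> inherits the
    bound \<open>r\<close> from both.\<close>
  have bound: "\<bar>m + \<tau> * a\<bar> \<le> r" if "0 \<le> a" "a \<le> b" "\<bar>y\<bar> = m + \<tau> * b" for a b
    using that assms(1-3) m by (auto simp: \<tau>_def abs_le_iff split: if_splits)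
  have "real i / sqrt N \<le> D / sqrt N" using i N by (simp add: divide_right_mono)
  then have z: "\<bar>?z\<bar> \<le> r"
    by (rule bound[OF _ _ y(1), rotated]) simp
  have "y - \<sigma> * ?z = \<sigma> * \<tau> * (D - real i) / sqrt N"
    by (subst y(2), subst y(1)) (use N in \<open>simp add: field_simps\<close>)
  moreover have "(\<sigma> * \<tau>)\<^sup>2 = 1" by (auto simp: \<sigma>_def \<tau>_def)
  ultimately have "real N * (y - \<sigma> * ?z)\<^sup>2 = (D - real i)\<^sup>2"
    using N assms by (simp add: power_mult_distrib power_divide)
  also have "\<dots> \<le> 1" using i by (auto simp: abs_square_le_1)
  finally have 1: "real N * (y - \<sigma> * ?z)\<^sup>2 \<le> 1" .
  have "D\<^sup>2 = real N * (\<bar>y\<bar> - m)\<^sup>2" by (simp add: D_def power_mult_distrib)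
  \<comment> \<open>Passing from quadratic to linear decay in the shell index makes the weights
    geometric.\<close>
  moreover have "D \<le> D\<^sup>2 + 1"
  proof -
    have "0 \<le> (D - 1/2)\<^sup>2" by simp
    then show ?thesis by (simp add: power2_eq_square algebra_simps)
  qed
  ultimately have 2: "real i \<le> real N * (\<bar>y\<bar> - m)\<^sup>2 + 1" using i by simp
  have "D \<le> 1 * sqrt N" unfolding D_def using assms m by (intro mult_right_mono) auto
  also have "sqrt N \<le> N" using assms by (intro real_le_lsqrt) (auto simp: power2_eq_square)
  finally have 3: "i \<le> N" using i by simp
  show ?thesis
    by (rule that[of \<sigma> \<tau> i]) (use z 1 2 3 in \<open>auto simp: \<sigma>_def \<tau>_def\<close>)
qed

text \<open>Replacing \<open>y\<close> by a center at distance at most \<open>1 / sqrt N\<close>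
  costs a bounded factor, because the centers stay away from 1 and -1. The quadratic decay then
  bounds the shell weights by a geometric series, uniformly in \<open>N\<close>.\<close>

lemma weight_near_le:
  assumes "c > 0" "m \<le> r" "r < 1"
    and c: "\<And>y. \<bar>y\<bar> \<le> 1 \<Longrightarrow> \<beta> * y ^ p - cross_entropy y y \<le> H \<beta> p m - c * (\<bar>y\<bar> - m)\<^sup>2"
  obtains C where "\<And>N. N \<ge> 1 \<Longrightarrow> (\<Sum>x\<in>{x \<in> configs N. \<bar>mean_spin N x\<bar> < r}.
      exp (\<beta> * real N * mean_spin N x ^ p) / (2 ^ N * exp (real N * H \<beta> p m))) \<le> C"
proof -
  \<comment> \<open>The term \<open>c\<close> pays for the \<open>+ 1\<close> in the bound on the
    shell index, \<open>1 / (1 - r^2)\<close> for the relative entropy.\<close>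
  define k where "k = c + 1 / (1 - r\<^sup>2)"
  have r: "1 - r\<^sup>2 > 0" using assms(2,3) m by (intro one_minus_square_pos) auto
  have "(\<Sum>x\<in>{x \<in> configs N. \<bar>mean_spin N x\<bar> < r}.
      exp (\<beta> * real N * mean_spin N x ^ p) / (2 ^ N * exp (real N * H \<beta> p m)))
      \<le> 4 * exp k * (1 / (1 - exp (- c)))" if N: "N \<ge> 1" for N
  proof -
    define z where "z = (\<lambda>(\<sigma>::real, \<tau>::real, i::nat). \<sigma> * (m + \<tau> * (real i / sqrt N)))"
    define w where "w = (\<lambda>(\<sigma>::real, \<tau>::real, i::nat). exp k * exp (- c) ^ i)"
    define I where "I = {-1, 1::real} \<times> {-1, 1::real} \<times> {..N}"
    define J where "J = {j \<in> I. \<bar>z j\<bar> \<le> r}"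
    have "(\<Sum>x\<in>{x \<in> configs N. \<bar>mean_spin N x\<bar> < r}.
      exp (\<beta> * real N * mean_spin N x ^ p) / (2 ^ N * exp (real N * H \<beta> p m))) \<le> sum w J"
    proof (rule sum_le_mixture_weights[where z = z])
      show "finite J" by (simp add: J_def I_def)
    next
      fix j assume "j \<in> J"
      then show "0 \<le> w j \<and> \<bar>z j\<bar> \<le> 1"
        using assms(3) by (auto simp: J_def w_def split: prod.splits)
    next
      fix x assume x: "x \<in> {x \<in> configs N. \<bar>mean_spin N x\<bar> < r}"
      define y where "y = mean_spin N x"
      have xc: "x \<in> configs N" and y: "\<bar>y\<bar> \<le> r" "\<bar>y\<bar> \<le> 1"
        using x assms(3) by (auto simp: y_def)
      obtain \<sigma> \<tau> i where i: "(\<sigma>, \<tau>, i) \<in> I" "\<bar>z (\<sigma>, \<tau>, i)\<bar> \<le> r"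
        "real N * (y - z (\<sigma>, \<tau>, i))\<^sup>2 \<le> 1" "real i \<le> real N * (\<bar>y\<bar> - m)\<^sup>2 + 1"
      proof (rule shell_center[OF y(1) assms(2) _ N])
        show "r \<le> 1" using assms(3) by simp
      qed (use that in \<open>auto simp: I_def z_def\<close>)
      define t where "t = z (\<sigma>, \<tau>, i)"
      have t: "\<bar>t\<bar> \<le> r" "real N * (y - t)\<^sup>2 \<le> 1" using i by (auto simp: t_def)
      have pos: "1 + t * x l > 0" if "l \<in> {1..N}" for l
        using configs_cases[OF xc that] t(1) assms(3) by auto
      have "\<bar>t\<bar>\<^sup>2 \<le> r\<^sup>2" by (rule power_mono[OF t(1)]) simp
      then have "t\<^sup>2 \<le> r\<^sup>2" by simp
      then have "(y - t)\<^sup>2 / (1 - t\<^sup>2) \<le> (y - t)\<^sup>2 / (1 - r\<^sup>2)"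
        using r by (intro divide_left_mono) auto
      then have "cross_entropy y y - cross_entropy y t \<le> (y - t)\<^sup>2 / (1 - r\<^sup>2)"
        using cross_entropy_diff_le[of y t] y t assms(3) by simp
      then have "real N * (cross_entropy y y - cross_entropy y t) \<le> real N * ((y - t)\<^sup>2 / (1 - r\<^sup>2))"
        by (intro mult_left_mono) auto
      also have "\<dots> \<le> 1 / (1 - r\<^sup>2)"
        using t(2) r by (simp add: divide_right_mono)
      finally have 1: "real N * (cross_entropy y y - cross_entropy y t) \<le> 1 / (1 - r\<^sup>2)" .
      have 2: "real N * (\<beta> * y ^ p - cross_entropy y y - H \<beta> p m) \<le> real N * (- (c * (\<bar>y\<bar> - m)\<^sup>2))"
        using c[OF y(2)] by (intro mult_left_mono) auto
      have "c * real i \<le> c * (real N * (\<bar>y\<bar> - m)\<^sup>2 + 1)"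
        using i(4) assms(1) by (intro mult_left_mono) auto
      with 1 2 have "real N * (\<beta> * y ^ p - cross_entropy y t - H \<beta> p m) \<le> k + real i * (- c)"
        by (simp add: k_def algebra_simps)
      then have "exp (real N * (\<beta> * y ^ p - cross_entropy y t - H \<beta> p m)) \<le> w (\<sigma>, \<tau>, i)"
        unfolding w_def by (simp flip: exp_of_nat_mult exp_add)
      then have "exp (\<beta> * real N * y ^ p) / (2 ^ N * exp (real N * H \<beta> p m))
          \<le> w (\<sigma>, \<tau>, i) * biased N t x"
        using weight_eq[OF N xc pos] biased_nonneg[OF xc, of t] t assms(3)
        by (simp add: y_def mult_right_mono)
      then show "\<exists>j\<in>J. exp (\<beta> * real N * mean_spin N x ^ p) / (2 ^ N * exp (real N * H \<beta> p m))
          \<le> w j * biased N (z j) x"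
        using i by (auto simp: y_def t_def J_def)
    qed auto
    also have "sum w J \<le> sum w I"
      by (rule sum_mono2) (auto simp: J_def I_def w_def)
    \<comment> \<open>The factor 4 counts the sign pairs; centers that coincide are counted with
      repetition.\<close>
    also have "\<dots> = 4 * exp k * (\<Sum>i\<le>N. exp (- c) ^ i)"
      by (simp add: I_def w_def sum.cartesian_product[symmetric] sum_distrib_left mult.assoc)
    also have "\<dots> \<le> 4 * exp k * (1 / (1 - exp (- c)))"
    proof (rule mult_left_mono)
      have "summable (\<lambda>i. exp (- c) ^ i)" "(\<Sum>i. exp (- c) ^ i) = 1 / (1 - exp (- c))"
        using assms(1) by (auto simp: summable_geometric suminf_geometric)
      then show "(\<Sum>i\<le>N. exp (- c) ^ i) \<le> 1 / (1 - exp (- c))"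
        using sum_le_suminf[of "\<lambda>i. exp (- c) ^ i" "{..N}"] by simp
    qed simp
    finally show ?thesis .
  qed
  then show ?thesis using that by blast
qed

lemma partition_fun_le:
  obtains C where "C > 0"
    "\<And>N. N \<ge> 1 \<Longrightarrow> partition_fun N \<beta> p \<le> C * (2 ^ N * exp (real N * H \<beta> p m))"
proof -
  obtain c where c: "c > 0"
    "\<And>y. \<bar>y\<bar> \<le> 1 \<Longrightarrow> \<beta> * y ^ p - cross_entropy y y \<le> H \<beta> p m - c * (\<bar>y\<bar> - m)\<^sup>2"
    using exponent_quadratic by blast
  \<comment> \<open>Any cut strictly between \<open>m\<close> and 1 works: beyond it the decay is
    exponential in \<open>N\<close>, below it \<open>1 - r^2\<close> is positive.\<close>
  define r where "r = (1 + m) / 2"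
  have r: "m < r" "r < 1" using m by (auto simp: r_def)
  let ?f = "\<lambda>N x. exp (\<beta> * real N * mean_spin N x ^ p) / (2 ^ N * exp (real N * H \<beta> p m))"
  obtain C where C: "\<And>N. N \<ge> 1 \<Longrightarrow> (\<Sum>x\<in>{x \<in> configs N. \<bar>mean_spin N x\<bar> < r}. ?f N x) \<le> C"
    by (rule weight_near_le[OF c(1) less_imp_le[OF r(1)] r(2)]) (erule c(2), rule that)
  define C' where "C' = max 1 (C + (1 + 1 / (c * (r - m)\<^sup>2)))"
  show ?thesis
  proof (rule that)
    show "C' > 0" by (simp add: C'_def)
    fix N :: nat assume N: "N \<ge> 1"
    have split: "configs N = {x \<in> configs N. \<bar>mean_spin N x\<bar> < r} \<union> {x \<in> configs N. \<bar>mean_spin N x\<bar> \<ge> r}"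
      by auto
    have "sum (?f N) (configs N) = (\<Sum>x\<in>{x \<in> configs N. \<bar>mean_spin N x\<bar> < r}. ?f N x)
        + (\<Sum>x\<in>{x \<in> configs N. \<bar>mean_spin N x\<bar> \<ge> r}. ?f N x)"
      by (subst split, rule sum.union_disjoint) auto
    also have "\<dots> \<le> C'"
      using C[OF N] weight_far_le[OF N c(1) r(1) c(2)] unfolding C'_def by linarith
    finally show "partition_fun N \<beta> p \<le> C' * (2 ^ N * exp (real N * H \<beta> p m))"
      by (simp add: partition_fun_def pos_divide_le_eq flip: sum_divide_distrib)
  qed
qed

subsection \<open>Comparison with the product measure of mean \<open>m\<close>\<close>

text \<open>On the window the quadratic error of \<open>exponent_ge\<close>, times \<open>N\<close>,
  is at most \<open>2 * K\<close>, and the partition function contributes the factor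
  \<open>C\<close>. Neither depends on \<open>N\<close> or \<open>x\<close>.\<close>

lemma gibbs_weight_ge_biased:
  obtains c where "c > 0"
    "\<And>N x. N \<ge> 1 \<Longrightarrow> x \<in> configs N \<Longrightarrow> real N * (mean_spin N x - m)\<^sup>2 \<le> 2 \<Longrightarrow>
      c * biased N m x \<le> exp (\<beta> * real N * mean_spin N x ^ p) / partition_fun N \<beta> p"
proof -
  obtain C where C: "C > 0"
    "\<And>N. N \<ge> 1 \<Longrightarrow> partition_fun N \<beta> p \<le> C * (2 ^ N * exp (real N * H \<beta> p m))"
    using partition_fun_le by blast
  define K where "K = \<beta> * (real p)\<^sup>2"
  have K: "K \<ge> 0" using beta_pos by (simp add: K_def)
  show ?thesis
  proof (rule that)
    show "exp (- (2 * K)) / C > 0" using C by simp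
    fix N x assume N: "N \<ge> 1" and x: "x \<in> configs N" and A: "real N * (mean_spin N x - m)\<^sup>2 \<le> 2"
    define y where "y = mean_spin N x"
    let ?Z = "2 ^ N * exp (real N * H \<beta> p m)"
    have pos: "1 + m * x l > 0" if "l \<in> {1..N}" for l
      using configs_cases[OF x that] m by auto
    have "real N * (- (K * (y - m)\<^sup>2)) \<le> real N * (\<beta> * y ^ p - cross_entropy y m - H \<beta> p m)"
      using exponent_ge[of y] abs_mean_spin_le[OF x N]
      by (intro mult_left_mono) (auto simp: K_def y_def)
    moreover have "K * (real N * (y - m)\<^sup>2) \<le> K * 2"
      using A K by (intro mult_left_mono) (auto simp: y_def)
    ultimately have "- (2 * K) \<le> real N * (\<beta> * y ^ p - cross_entropy y m - H \<beta> p m)"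
      by (simp add: algebra_simps)
    then have "exp (- (2 * K)) * biased N m x \<le> exp (\<beta> * real N * y ^ p) / ?Z"
      unfolding y_def using m
      by (subst weight_eq[OF N x pos]) (auto intro!: mult_right_mono biased_nonneg[OF x])
    then have "exp (- (2 * K)) * biased N m x / C \<le> exp (\<beta> * real N * y ^ p) / ?Z / C"
      using C by (intro divide_right_mono) auto
    also have "\<dots> = exp (\<beta> * real N * y ^ p) / (C * ?Z)" by simp
    also have "\<dots> \<le> exp (\<beta> * real N * y ^ p) / partition_fun N \<beta> p"
      using C partition_fun_pos N by (intro divide_left_mono) auto
    finally show "exp (- (2 * K)) / C * biased N m x
        \<le> exp (\<beta> * real N * mean_spin N x ^ p) / partition_fun N \<beta> p"
      by (simp add: y_def)
  qed
qed

lemma biased_measure_le_curie_weiss: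
  obtains c where "c > 0"
    "\<And>N B. N \<ge> 1 \<Longrightarrow> B \<subseteq> configs N \<Longrightarrow>
      c * (\<Sum>x\<in>{x \<in> B. real N * (mean_spin N x - m)\<^sup>2 \<le> 2}. biased N m x)
        \<le> measure (curie_weiss N \<beta> p) B"
proof -
  obtain c where c: "c > 0"
    "\<And>N x. N \<ge> 1 \<Longrightarrow> x \<in> configs N \<Longrightarrow> real N * (mean_spin N x - m)\<^sup>2 \<le> 2 \<Longrightarrow>
      c * biased N m x \<le> exp (\<beta> * real N * mean_spin N x ^ p) / partition_fun N \<beta> p"
    using gibbs_weight_ge_biased by blast
  show ?thesis
  proof (rule that[OF c(1)])
    fix N B assume N: "N \<ge> (1::nat)" and B: "B \<subseteq> configs N"
    let ?A = "{x \<in> B. real N * (mean_spin N x - m)\<^sup>2 \<le> 2}"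
    have fin: "finite B" using B finite_subset finite_configs by blast
    have "c * (\<Sum>x\<in>?A. biased N m x) = (\<Sum>x\<in>?A. c * biased N m x)"
      by (rule sum_distrib_left)
    also have "\<dots> \<le> (\<Sum>x\<in>?A. exp (\<beta> * real N * mean_spin N x ^ p) / partition_fun N \<beta> p)"
      using c(2)[OF N] B by (intro sum_mono) auto
    also have "\<dots> \<le> (\<Sum>x\<in>B. exp (\<beta> * real N * mean_spin N x ^ p) / partition_fun N \<beta> p)"
      using fin partition_fun_pos[of N \<beta> p] by (intro sum_mono2) auto
    also have "\<dots> = measure (curie_weiss N \<beta> p) B"
      using measure_curie_weiss[OF B] by (simp add: sum_divide_distrib)
    finally show "c * (\<Sum>x\<in>?A. biased N m x) \<le> measure (curie_weiss N \<beta> p) B" .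
  qed
qed

end

text \<open>The cardinality condition is a disjunction because \<open>card\<close> is 0 on infinite
  sets.\<close>

theorem theorem1:
  fixes m :: real
  assumes "0 \<le> m" and "m < 1"
    and "infinite (Theta m) \<or> card (Theta m) \<ge> 2"
  shows "\<not> (\<exists>T. consistent_estimators T (Theta m))"
proof
  assume "\<exists>T. consistent_estimators T (Theta m)"
  then obtain T where T: "consistent_estimators T (Theta m)" by blast
  obtain \<beta>1 p1 \<beta>2 p2 where Th: "(\<beta>1, p1) \<in> Theta m" "(\<beta>2, p2) \<in> Theta m" "(\<beta>1, p1) \<noteq> (\<beta>2, p2)"
  proof -
    have "\<not> (\<forall>a\<in>Theta m. \<forall>b\<in>Theta m. a = b)"
    proof
      assume *: "\<forall>a\<in>Theta m. \<forall>b\<in>Theta m. a = b"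
      then obtain a where "Theta m \<subseteq> {a}" by blast
      then have "finite (Theta m)" "card (Theta m) \<le> 1"
        using finite_subset card_mono[of "{a}" "Theta m"] by auto
      then show False using assms(3) by auto
    qed
    then show ?thesis using that by auto
  qed
  interpret M1: maximizer \<beta>1 p1 m by unfold_locales (use assms Th in auto)
  interpret M2: maximizer \<beta>2 p2 m by unfold_locales (use assms Th in auto)
  define \<theta>1 \<theta>2 where "\<theta>1 = (\<beta>1, real p1)" and "\<theta>2 = (\<beta>2, real p2)"
  \<comment> \<open>With a third of the distance, no value of the estimator is within
    \<open>\<epsilon>\<close> of both parameters, so the two error events cover all
    configurations.\<close>
  define \<epsilon> where "\<epsilon> = norm (\<theta>1 - \<theta>2) / 3"
  have \<epsilon>: "\<epsilon> > 0" using Th(3) by (auto simp: \<epsilon>_def \<theta>1_def \<theta>2_def zero_prod_def)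
  define B where "B \<theta> N = {x \<in> configs N. norm (T N x - \<theta>) > \<epsilon>}" for \<theta> N
  have cons: "(\<lambda>N. measure (curie_weiss N \<beta>1 p1) (B \<theta>1 N)) \<longlonglongrightarrow> 0"
    "(\<lambda>N. measure (curie_weiss N \<beta>2 p2) (B \<theta>2 N)) \<longlonglongrightarrow> 0"
    using T Th(1,2) \<epsilon> unfolding consistent_estimators_def B_def \<theta>1_def \<theta>2_def by auto
  obtain c1 where c1: "c1 > 0" "\<And>N B. N \<ge> 1 \<Longrightarrow> B \<subseteq> configs N \<Longrightarrow>
      c1 * (\<Sum>x\<in>{x \<in> B. real N * (mean_spin N x - m)\<^sup>2 \<le> 2}. biased N m x)
        \<le> measure (curie_weiss N \<beta>1 p1) B"
    using M1.biased_measure_le_curie_weiss by blast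
  obtain c2 where c2: "c2 > 0" "\<And>N B. N \<ge> 1 \<Longrightarrow> B \<subseteq> configs N \<Longrightarrow>
      c2 * (\<Sum>x\<in>{x \<in> B. real N * (mean_spin N x - m)\<^sup>2 \<le> 2}. biased N m x)
        \<le> measure (curie_weiss N \<beta>2 p2) B"
    using M2.biased_measure_le_curie_weiss by blast
  \<comment> \<open>Dividing by \<open>c1\<close> and \<open>c2\<close> turns the error
    probabilities into bounds for the same product measure on the window, whose mass is at least
    1/2; consistency sends the sum to 0.\<close>
  let ?s = "\<lambda>N. measure (curie_weiss N \<beta>1 p1) (B \<theta>1 N) / c1
      + measure (curie_weiss N \<beta>2 p2) (B \<theta>2 N) / c2"
  have "1 / 2 \<le> ?s N" if N: "N \<ge> 1" for N
  proof -
    define Q where "Q B = (\<Sum>x\<in>{x \<in> B. real N * (mean_spin N x - m)\<^sup>2 \<le> 2}. biased N m x)" for B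
    have cover: "configs N = B \<theta>1 N \<union> B \<theta>2 N"
    proof
      show "configs N \<subseteq> B \<theta>1 N \<union> B \<theta>2 N"
      proof
        fix x assume x: "x \<in> configs N"
        have "norm (\<theta>1 - \<theta>2) \<le> norm (T N x - \<theta>1) + norm (T N x - \<theta>2)"
          by (metis dist_norm dist_triangle3)
        then have "norm (T N x - \<theta>1) > \<epsilon> \<or> norm (T N x - \<theta>2) > \<epsilon>"
          using \<epsilon> unfolding \<epsilon>_def by linarith
        then show "x \<in> B \<theta>1 N \<union> B \<theta>2 N" using x by (auto simp: B_def)
      qed
    qed (auto simp: B_def)
    have sub: "B \<theta>1 N \<subseteq> configs N" "B \<theta>2 N \<subseteq> configs N" by (auto simp: B_def)
    have fin: "finite (B \<theta>1 N)" "finite (B \<theta>2 N)" by (auto simp: B_def)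
    have "1 / 2 \<le> Q (configs N)"
      unfolding Q_def using biased_concentration[OF N, of m] assms by simp
    also have "\<dots> = (\<Sum>x\<in>{x \<in> B \<theta>1 N. real N * (mean_spin N x - m)\<^sup>2 \<le> 2}
        \<union> {x \<in> B \<theta>2 N. real N * (mean_spin N x - m)\<^sup>2 \<le> 2}. biased N m x)"
      unfolding Q_def by (subst cover) (auto intro!: sum.cong)
    also have "\<dots> \<le> Q (B \<theta>1 N) + Q (B \<theta>2 N)"
      unfolding Q_def using fin sub assms
      by (subst sum.union_inter[symmetric]) (auto intro!: sum_nonneg biased_nonneg)
    also have "\<dots> \<le> ?s N"
      using c1 c2 N sub unfolding Q_def by (intro add_mono) (auto simp: pos_le_divide_eq mult.commute)
    finally show ?thesis .
  qed
  moreover have "?s \<longlonglongrightarrow> 0 / c1 + 0 / c2"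
    using c1(1) c2(1) by (intro tendsto_intros cons) auto
  ultimately have "1 / 2 \<le> 0 / c1 + 0 / c2"
    by (intro LIMSEQ_le_const[of ?s] exI[of _ 1]) blast+
  then show False by simp
qed

end
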